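(* Let $b\ge 2$ be an integer and let $(T_b,\omega_0,\mu_c)$ be the homogeneous model tree with branching $b$ and root $x_0$, with standard edge weight $\omega_0$ and weighted counting measure $\mu_c\equiv c>0$. Let $d$ be the standard graph distance on $T_b$. Let $V:T_b\to\mathbb{R}$ with $V>0$ on $T_b$, and assume that for some $\alpha>1$, $R_0\ge 2$ and $C_0>0$, $$V(x)\le C_0\,d^{-\alpha}(x,x_0)\quad\text{for all }x\in T_b\setminus B_{R_0}(x_0).$$ Then there exist infinitely many bounded solutions $u:T_b\to\mathbb{R}$ of $\Delta u-Vu=0$ in $T_b$. In particular, for every real $\gamma>0$ there exists a solution $u$ of $\Delta u-Vu=0$ in $T_b$ such that $u(x)\to\gamma$ as $d(x,x_0)\to+\infty$.
   Context: The homogeneous model tree $T_b$ with branching $b$ and root $x_0$ is the infinite rooted tree in which every vertex at graph distance $r\ge 0$ from the root $x_0$ is joined to exactly $b$ vertices at distance $r+1$, and every vertex other than $x_0$ is joined to exactly one vertex at distance $r-1$ (so the root has $b$ neighbours and every other vertex has $b+1$ neighbours). The standard graph distance $d(x,y)$ is the number of edges in a shortest path from $x$ to $y$. The standard edge weight is $\omega_0(x,y)=1$ if $x,y$ are joined by an edge (i.e. $d(x,y)=1$) and $\omega_0(x,y)=0$ otherwise. The weighted counting measure $\mu_c$ is the constant function $\mu_c(x)=c$, for a constant $c>0$. The Laplacian is $\Delta f(x)=\frac{1}{\mu_c(x)}\sum_{y\in T_b}[f(y)-f(x)]\,\omega_0(x,y)$. $B_r(x_0)=\{x\in T_b: d(x,x_0)<r\}$,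 and $d^{p}(x,y)=(d(x,y))^{p}$. A solution of $\Delta u-Vu=0$ in $T_b$ is a function $u:T_b\to\mathbb{R}$ satisfying the equation at every vertex. *)

theory Defs
  imports "HOL-Analysis.Analysis"
begin

text \<open>
  A graph is given by its adjacency relation \<open>E :: 'v \<Rightarrow> 'v \<Rightarrow> bool\<close>; its vertex set is
  the whole type \<open>'v\<close>, so that a real function on the vertices is just a function
  \<open>'v \<Rightarrow> real\<close>.
\<close>

definition simple_graph :: "('v \<Rightarrow> 'v \<Rightarrow> bool) \<Rightarrow> bool" where
  "simple_graph E \<longleftrightarrow> symp E \<and> irreflp E"

definition connected_graph :: "('v \<Rightarrow> 'v \<Rightarrow> bool) \<Rightarrow> bool" where
  "connected_graph E \<longleftrightarrow> (\<forall>x y. E\<^sup>*\<^sup>* x y)"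

text \<open>A cycle is listed without repeating its starting vertex.\<close>

definition is_cycle :: "('v \<Rightarrow> 'v \<Rightarrow> bool) \<Rightarrow> 'v list \<Rightarrow> bool" where
  "is_cycle E xs \<longleftrightarrow>
     length xs \<ge> 3 \<and> distinct xs \<and> successively E xs \<and> E (last xs) (hd xs)"

definition tree_graph :: "('v \<Rightarrow> 'v \<Rightarrow> bool) \<Rightarrow> bool" where
  "tree_graph E \<longleftrightarrow> simple_graph E \<and> connected_graph E \<and> (\<nexists>xs. is_cycle E xs)"

text \<open>
  \<open>(E ^^ n) x y\<close> says that some walk with exactly \<open>n\<close> edges joins \<open>x\<close> to \<open>y\<close>. The value is
  meaningful when \<open>x\<close> and \<open>y\<close> are connected.
\<close>

definition graph_dist :: "('v \<Rightarrow> 'v \<Rightarrow> bool) \<Rightarrow> 'v \<Rightarrow> 'v \<Rightarrow> nat" where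
  "graph_dist E x y = (LEAST n. (E ^^ n) x y)"

definition graph_ball :: "('v \<Rightarrow> 'v \<Rightarrow> bool) \<Rightarrow> 'v \<Rightarrow> real \<Rightarrow> 'v set" where
  "graph_ball E x0 r = {x. real (graph_dist E x x0) < r}"

definition homogeneous_model_tree :: "nat \<Rightarrow> ('v \<Rightarrow> 'v \<Rightarrow> bool) \<Rightarrow> 'v \<Rightarrow> bool" where
  "homogeneous_model_tree b E x0 \<longleftrightarrow>
     tree_graph E \<and> infinite (UNIV :: 'v set) \<and>
     (\<forall>x. finite {y. E x y \<and> graph_dist E y x0 = graph_dist E x x0 + 1} \<and>
          card {y. E x y \<and> graph_dist E y x0 = graph_dist E x x0 + 1} = b) \<and>
     (\<forall>x. x \<noteq> x0 \<longrightarrow> (\<exists>!y. E x y \<and> graph_dist E y x0 + 1 = graph_dist E x x0))"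

definition standard_weight :: "('v \<Rightarrow> 'v \<Rightarrow> bool) \<Rightarrow> 'v \<Rightarrow> 'v \<Rightarrow> real" where
  "standard_weight E x y = (if E x y then 1 else 0)"

definition counting_measure :: "real \<Rightarrow> 'v \<Rightarrow> real" where
  "counting_measure c x = c"

text \<open>
  The sum runs over all vertices. On a locally finite graph with the standard weight only
  finitely many terms are nonzero, so it is a finite sum.
\<close>

definition graph_laplacian ::
    "('v \<Rightarrow> 'v \<Rightarrow> real) \<Rightarrow> ('v \<Rightarrow> real) \<Rightarrow> ('v \<Rightarrow> real) \<Rightarrow> 'v \<Rightarrow> real" where
  "graph_laplacian \<omega> \<mu> f x = 1 / \<mu> x * (\<Sum>\<^sub>\<infinity>y\<in>UNIV. (f y - f x) * \<omega> x y)"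

definition schroedinger_solution ::
    "('v \<Rightarrow> 'v \<Rightarrow> real) \<Rightarrow> ('v \<Rightarrow> real) \<Rightarrow> ('v \<Rightarrow> real) \<Rightarrow> ('v \<Rightarrow> real) \<Rightarrow> bool" where
  "schroedinger_solution \<omega> \<mu> V u \<longleftrightarrow> (\<forall>x. graph_laplacian \<omega> \<mu> u x - V x * u x = 0)"

end

theory Submission
  imports Defs
begin

text \<open>
  Monotone iteration, started at the constant supersolution \<open>\<gamma>\<close>, produces a solution above any
  subsolution that lies below \<open>\<gamma>\<close>. The subsolution is \<open>\<gamma> - h\<close>, where \<open>h \<ge> 0\<close> depends only on the
  distance \<open>r\<close> to the root, \<open>h \<rightarrow> 0\<close> and \<open>- \<Delta> h \<ge> \<gamma> V\<close>. In terms of the decrements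
  \<open>\<delta> r = h r - h (r + 1)\<close> the last condition is the first-order recursion
  \<open>b \<delta> r - \<delta> (r - 1) \<ge> W r\<close>, where \<open>W\<close> dominates \<open>\<gamma> c V\<close> on spheres. If \<open>W\<close> is summable, which is
  where \<open>\<alpha> > 1\<close> enters, and \<open>b \<ge> 2\<close>, then \<open>\<delta>\<close> is summable and \<open>h r\<close> is its tail from \<open>r\<close> on.
\<close>

section \<open>Monotone iteration between a subsolution and a supersolution\<close>

lemma solution_between_sub_super:
  fixes N :: "'v \<Rightarrow> 'v set" and q v w :: "'v \<Rightarrow> real"
  assumes q: "\<And>x. q x > 0"
    and super: "\<And>x. sum v (N x) \<le> q x * v x"
    and sub: "\<And>x. q x * w x \<le> sum w (N x)"
    and le: "\<And>x. w x \<le> v x"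
  obtains u where "\<And>x. w x \<le> u x" "\<And>x. u x \<le> v x" "\<And>x. q x * u x = sum u (N x)"
proof -
  \<comment> \<open>The fixed points of \<open>T\<close> are exactly the solutions sought, and
    \<open>T\<close> is monotone because \<open>q\<close> is positive.\<close>
  define T where "T f x = sum f (N x) / q x" for f :: "'v \<Rightarrow> real" and x
  define U where "U n = (T ^^ n) v" for n
  have U0: "U 0 x = v x" and US: "U (Suc n) x = T (U n) x" for n x
    by (simp_all add: U_def)
  have mono: "T f x \<le> T g x" if "\<And>x. f x \<le> g x" for f g x
    unfolding T_def by (intro divide_right_mono sum_mono that less_imp_le[OF q])
  have dec: "U (Suc n) x \<le> U n x" for n x
  proof (induction n arbitrary: x)
    case 0
    show ?case using super[of x] q[of x] by (simp add: U0 US T_def U_def field_simps)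
  next
    case (Suc n)
    show ?case using mono[of "U (Suc n)" "U n", OF Suc] by (simp only: US)
  qed
  have lower: "w x \<le> U n x" for n x
  proof (induction n arbitrary: x)
    case 0
    show ?case by (simp add: U0 le)
  next
    case (Suc n)
    have "w x \<le> T w x" using sub[of x] q[of x] by (simp add: T_def field_simps)
    also have "\<dots> \<le> U (Suc n) x" unfolding US by (rule mono) (rule Suc)
    finally show ?case .
  qed
  have decseq: "decseq (\<lambda>n. U n x)" for x
    by (rule decseq_SucI) (rule dec)
  have "\<exists>l. (\<lambda>n. U n x) \<longlonglongrightarrow> l" for x
    using decseq_convergent[OF decseq, of "w x" x] lower by metis
  then obtain u where u: "\<And>x. (\<lambda>n. U n x) \<longlonglongrightarrow> u x" by metis
  show thesis
  proof
    fix x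
    show "w x \<le> u x" by (rule LIMSEQ_le_const[OF u]) (use lower in blast)
    show "u x \<le> v x" using decseq_ge[OF decseq u, of x 0] by (simp add: U0)
    \<comment> \<open>The iteration rule and the limit \<open>u\<close> give two limits for the same
      sequence; equating them is the fixed-point equation.\<close>
    have "(\<lambda>n. q x * U (Suc n) x) \<longlonglongrightarrow> sum u (N x)"
      using q[of x] by (simp add: US T_def tendsto_sum u)
    moreover have "(\<lambda>n. q x * U (Suc n) x) \<longlonglongrightarrow> q x * u x"
      by (intro tendsto_mult_left LIMSEQ_Suc u)
    ultimately show "q x * u x = sum u (N x)" using LIMSEQ_unique by blast
  qed
qed

section \<open>The equation as a finite identity at each vertex\<close>

lemma graph_laplacian_standard:
  assumes "finite {y. E x y}"
  shows "graph_laplacian (standard_weight E) (counting_measure c) f x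
           = 1 / c * (\<Sum>y | E x y. f y - f x)"
proof -
  have "(\<Sum>\<^sub>\<infinity>y\<in>UNIV. (f y - f x) * standard_weight E x y) = (\<Sum>\<^sub>\<infinity>y\<in>{y. E x y}. f y - f x)"
    by (rule infsum_cong_neutral) (auto simp: standard_weight_def)
  with assms show ?thesis
    by (simp add: graph_laplacian_def counting_measure_def)
qed

text \<open>Multiplying by \<open>c\<close> and collecting the terms in \<open>u x\<close> gives the
  form that monotone iteration solves, with \<open>q x\<close> the degree plus
  \<open>c * V x\<close>.\<close>

lemma schroedinger_solution_standard_iff:
  assumes fin: "\<And>x. finite {y. E x y}" and c: "c > 0"
  shows "schroedinger_solution (standard_weight E) (counting_measure c) V u \<longleftrightarrow>
           (\<forall>x. (real (card {y. E x y}) + c * V x) * u x = sum u {y. E x y})"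
proof -
  have "graph_laplacian (standard_weight E) (counting_measure c) u x - V x * u x = 0 \<longleftrightarrow>
          (real (card {y. E x y}) + c * V x) * u x = sum u {y. E x y}" for x
    using c by (auto simp: graph_laplacian_standard[OF fin] sum_subtractf field_simps)
  then show ?thesis by (simp add: schroedinger_solution_def)
qed

section \<open>The radial recursion\<close>

lemma summable_linear_recursion:
  fixes \<delta> W :: "nat \<Rightarrow> real"
  assumes "b > 1" and W: "\<And>n. W n \<ge> 0" "summable W"
    and \<delta>: "\<And>n. \<delta> n \<ge> 0" "b * \<delta> 0 = W 0" "\<And>n. b * \<delta> (Suc n) = \<delta> n + W (Suc n)"
  shows "summable \<delta>"
proof (rule bounded_imp_summable)
  fix n
  \<comment> \<open>Summing the recursion reproduces the partial sum of \<delta> on the right, short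
    of its last term. Dropping \<open>\<delta> n\<close> from the left then leaves the factor
    \<open>b - 1 > 0\<close>.\<close>
  have "b * (\<Sum>k\<le>n. \<delta> k) + \<delta> n = (\<Sum>k\<le>n. \<delta> k) + (\<Sum>k\<le>n. W k)"
    by (induction n) (simp_all add: \<delta> distrib_left)
  moreover have "(\<Sum>k\<le>n. W k) \<le> suminf W"
    by (intro sum_le_suminf W) auto
  ultimately have "(b - 1) * (\<Sum>k\<le>n. \<delta> k) \<le> suminf W"
    using \<delta>(1)[of n] by (simp add: algebra_simps)
  then show "(\<Sum>k\<le>n. \<delta> k) \<le> suminf W / (b - 1)"
    using \<open>b > 1\<close> by (simp add: field_simps)
qed (rule \<delta>)

text \<open>Here \<open>g\<close> is the function h of the overview. Index 0 has its own equation
  because the root has no parent; the bound by \<open>g 0\<close> later makes the solution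
  bounded.\<close>

lemma radial_supersolution:
  fixes b :: real and W :: "nat \<Rightarrow> real"
  assumes b: "b > 1" and W: "\<And>n. W n \<ge> 0" "summable W"
  obtains g :: "nat \<Rightarrow> real" where "\<And>n. g n \<ge> 0" "\<And>n. g n \<le> g 0" "g \<longlonglongrightarrow> 0"
    "b * (g 0 - g 1) = W 0"
    "\<And>n. b * (g (Suc n) - g (Suc (Suc n))) - (g n - g (Suc n)) = W (Suc n)"
proof -
  define \<delta> where "\<delta> = rec_nat (W 0 / b) (\<lambda>n d. (d + W (Suc n)) / b)"
  have \<delta>_rec: "b * \<delta> 0 = W 0" "b * \<delta> (Suc n) = \<delta> n + W (Suc n)" for n
    using b by (simp_all add: \<delta>_def)
  have \<delta>_nonneg: "\<delta> n \<ge> 0" for n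
    by (induction n) (use b W in \<open>simp_all add: \<delta>_def\<close>)
  have summable: "summable \<delta>"
    by (rule summable_linear_recursion[OF b W \<delta>_nonneg \<delta>_rec])
  define g where "g n = (\<Sum>k. \<delta> (k + n))" for n
  have diff: "g n - g (Suc n) = \<delta> n" for n
    using suminf_split_head[OF summable_ignore_initial_segment[OF summable, of n]]
    by (simp add: g_def)
  have "decseq g"
    by (rule decseq_SucI) (use diff \<delta>_nonneg in \<open>metis diff_ge_0_iff_ge\<close>)
  show thesis
  proof
    show "g n \<ge> 0" for n
      unfolding g_def
      by (intro suminf_nonneg summable_ignore_initial_segment summable \<delta>_nonneg)
    show "g n \<le> g 0" for n
      using \<open>decseq g\<close> by (simp add: decseq_def)
    show "g \<longlonglongrightarrow> 0"
      unfolding g_def by (rule suminf_exist_split2[OF summable])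
    show "b * (g 0 - g 1) = W 0"
      using diff[of 0] \<delta>_rec by simp
    show "b * (g (Suc n) - g (Suc (Suc n))) - (g n - g (Suc n)) = W (Suc n)" for n
      using \<delta>_rec by (simp add: diff)
  qed
qed

section \<open>Graph distance\<close>

lemma graph_dist_self [simp]: "graph_dist E x x = 0"
  by (simp add: graph_dist_def)

lemma relpowp_graph_dist:
  assumes "connected_graph E"
  shows "(E ^^ graph_dist E x y) x y"
  unfolding graph_dist_def
  using assms rtranclp_imp_relpowp by (metis connected_graph_def LeastI_ex)

lemma graph_dist_eq_0_iff:
  assumes "connected_graph E"
  shows "graph_dist E x y = 0 \<longleftrightarrow> x = y"
  using relpowp_graph_dist[OF assms, of x y] by auto

lemma graph_dist_edge_le:
  assumes "connected_graph E" "E x y"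
  shows "graph_dist E x z \<le> graph_dist E y z + 1"
proof -
  have "(E ^^ Suc (graph_dist E y z)) x z"
    using assms relpowp_graph_dist by (metis relpowp_Suc_I2)
  then show ?thesis
    unfolding graph_dist_def[of E x z] by (simp add: Least_le)
qed

section \<open>Levels of the model tree\<close>

context
  fixes b :: nat and E :: "'v \<Rightarrow> 'v \<Rightarrow> bool" and x0 :: 'v
  assumes tree: "homogeneous_model_tree b E x0"
begin

private abbreviation (input) "lev x \<equiv> graph_dist E x x0"

private lemma conn: "connected_graph E" and sym: "E x y \<Longrightarrow> E y x" and irrefl: "\<not> E x x"
  and acyclic: "\<not> is_cycle E xs"
  using tree by (auto simp: homogeneous_model_tree_def tree_graph_def simple_graph_def
      dest: sympD irreflpD)

private lemma finite_children: "finite {y. E x y \<and> lev y = lev x + 1}"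
  and card_children: "card {y. E x y \<and> lev y = lev x + 1} = b"
  using tree by (auto simp: homogeneous_model_tree_def)

private lemma ex1_parent: "x \<noteq> x0 \<Longrightarrow> \<exists>!y. E x y \<and> lev y + 1 = lev x"
  using tree by (auto simp: homogeneous_model_tree_def)

text \<open>The parents of \<open>x\<close> and \<open>y\<close> either coincide, or are joined by a
  path from the induction hypothesis, which is extended by \<open>x\<close> and \<open>y\<close>.
  The level bound keeps \<open>x\<close> and \<open>y\<close> off the shorter path, so the longer
  one stays distinct.\<close>

private lemma path_same_level:
  assumes "lev x = n" "lev y = n" "x \<noteq> y"
  shows "\<exists>xs. length xs \<ge> 3 \<and> distinct xs \<and> successively E xs \<and> hd xs = x \<and> last xs = y \<and>
           (\<forall>z\<in>set xs. lev z \<le> n)"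
  using assms
proof (induction n arbitrary: x y)
  case 0
  then show ?case using conn by (simp add: graph_dist_eq_0_iff)
next
  case (Suc n)
  then have "x \<noteq> x0" "y \<noteq> x0" by auto
  then obtain p r where "E x p" "lev p + 1 = lev x" "E y r" "lev r + 1 = lev y"
    using ex1_parent by blast
  then have pr: "E p x" "lev p = n" "E r y" "lev r = n" using Suc.prems(1,2) sym by simp_all
  show ?case
  proof (cases "p = r")
    case True
    have "x \<noteq> p" "p \<noteq> y" using Suc.prems(1,2) pr(2) by (metis n_not_Suc_n)+
    moreover have "lev x \<le> Suc n" "lev y \<le> Suc n" "lev p \<le> Suc n" using Suc.prems pr by simp_all
    ultimately show ?thesis
      using Suc.prems(3) pr(1,3) True sym[of p x]
      by (intro exI[of _ "[x, p, y]"]) simp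
  next
    case False
    from Suc.IH[OF pr(2,4) False] obtain xs where xs:
      "length xs \<ge> 3" "distinct xs" "successively E xs" "hd xs = p" "last xs = r"
      "\<forall>z\<in>set xs. lev z \<le> n" by blast
    then have "x \<notin> set xs" "y \<notin> set xs" "xs \<noteq> []" using Suc.prems(1,2) by fastforce+
    moreover have "lev z \<le> Suc n" if "z \<in> set (x # xs @ [y])" for z
      using that Suc.prems(1,2) xs(6) by (auto intro: le_SucI)
    ultimately show ?thesis
      using Suc.prems(3) xs(1-5) pr(1,3) sym[of p x]
      by (intro exI[of _ "x # xs @ [y]"])
        (auto simp: successively_append_iff successively_Cons)
  qed
qed

text \<open>The definition of the model tree counts only neighbours one level away. An edge inside a
  level would close the path of \<open>path_same_level\<close> to a cycle; larger jumps contradict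
  the triangle inequality.\<close>

private lemma edge_level:
  assumes "E x y"
  shows "lev y = lev x + 1 \<or> lev y + 1 = lev x"
proof -
  have "lev x \<noteq> lev y"
  proof
    assume eq: "lev x = lev y"
    have "x \<noteq> y" using assms irrefl by auto
    from path_same_level[OF eq refl this] show False
      using acyclic sym[OF assms] by (auto simp: is_cycle_def)
  qed
  with graph_dist_edge_le[OF conn assms, of x0] graph_dist_edge_le[OF conn sym[OF assms], of x0]
  show ?thesis by linarith
qed

private lemma neighbours:
  "{y. E x y} = {y. E x y \<and> lev y = lev x + 1} \<union> {y. E x y \<and> lev y + 1 = lev x}"
  using edge_level by auto

private lemma parents:
  obtains "x = x0" "{y. E x y \<and> lev y + 1 = lev x} = {}"
  | p where "x \<noteq> x0" "lev x = Suc (lev p)" "{y. E x y \<and> lev y + 1 = lev x} = {p}"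
proof (cases "x = x0")
  case False
  then obtain p where p: "E x p \<and> lev p + 1 = lev x"
    "\<And>y. E x y \<and> lev y + 1 = lev x \<Longrightarrow> y = p"
    using ex1_parent by metis
  have "lev x = Suc (lev p)" using p(1) by linarith
  moreover have "{y. E x y \<and> lev y + 1 = lev x} = {p}" using p by blast
  ultimately show ?thesis using False that(2) by blast
qed (use that in auto)

lemma model_tree_finite_neighbours: "finite {y. E x y}"
  unfolding neighbours using finite_children by (rule finite_UnI) (cases rule: parents[of x]; simp)

text \<open>Children contribute \<open>b\<close> equal terms and the parent one. The natural
  subtraction \<open>lev x - 1\<close> is evaluated only off the root, where it does not
  truncate.\<close>

lemma model_tree_sum_radial:
  fixes g :: "nat \<Rightarrow> real"
  shows "(\<Sum>y | E x y. g (lev y)) =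
           real b * g (lev x + 1) + (if x = x0 then 0 else g (lev x - 1))"
proof -
  have fin: "finite {y. E x y \<and> lev y + 1 = lev x}"
    by (cases rule: parents[of x]) simp_all
  have "(\<Sum>y | E x y. g (lev y)) = (\<Sum>y | E x y \<and> lev y = lev x + 1. g (lev y))
          + (\<Sum>y | E x y \<and> lev y + 1 = lev x. g (lev y))"
    unfolding neighbours by (rule sum.union_disjoint[OF finite_children fin]) auto
  also have "(\<Sum>y | E x y \<and> lev y = lev x + 1. g (lev y)) = real b * g (lev x + 1)"
    using card_children[of x] by simp
  also have "(\<Sum>y | E x y \<and> lev y + 1 = lev x. g (lev y))
               = (if x = x0 then 0 else g (lev x - 1))"
    by (cases rule: parents[of x]) simp_all
  finally show ?thesis .
qed

lemma model_tree_finite_sphere: "finite {x. lev x = n}"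
proof (induction n)
  case 0
  then show ?case using conn by (simp add: graph_dist_eq_0_iff)
next
  case (Suc n)
  have "{x. lev x = Suc n} \<subseteq> (\<Union>p\<in>{x. lev x = n}. {y. E p y})"
  proof
    fix x assume "x \<in> {x. lev x = Suc n}"
    then have x: "lev x = Suc n" "x \<noteq> x0" by auto
    with ex1_parent obtain p where "E x p" "lev p + 1 = lev x" by blast
    with x sym show "x \<in> (\<Union>p\<in>{x. lev x = n}. {y. E p y})" by auto
  qed
  moreover have "finite (\<Union>p\<in>{x. lev x = n}. {y. E p y})"
    using Suc model_tree_finite_neighbours by simp
  ultimately show ?case by (rule finite_subset)
qed

text \<open>This filter encodes distance to the root tending to infinity; its properness makes
  limits along it unique. Bounded levels would cover the infinite vertex set by finitely many finite
  spheres.\<close>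

lemma model_tree_at_infinity_not_bot: "filtercomap lev at_top \<noteq> bot"
proof -
  have "\<exists>x. lev x \<ge> n" for n
  proof (rule ccontr)
    assume "\<not> ?thesis"
    then have "(UNIV :: 'v set) = (\<Union>k<n. {x. lev x = k})" by (auto simp: not_le)
    then have "finite (UNIV :: 'v set)"
      using model_tree_finite_sphere by (metis finite_UN finite_lessThan)
    then show False using tree by (simp add: homogeneous_model_tree_def)
  qed
  then show ?thesis
    by (intro filtercomap_neq_bot) (auto simp: eventually_at_top_linorder)
qed

section \<open>Solutions with a prescribed limit\<close>

lemma model_tree_solution_with_limit:
  fixes V :: "'v \<Rightarrow> real" and W :: "nat \<Rightarrow> real"
  assumes b: "b \<ge> 2" and c: "c > 0" and V: "\<And>x. V x > 0"
    and W: "\<And>x. V x \<le> W (lev x)" "\<And>n. W n \<ge> 0" "summable W" and \<gamma>: "\<gamma> > 0"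
  shows "\<exists>u. bounded (range u) \<and>
           schroedinger_solution (standard_weight E) (counting_measure c) V u \<and>
           (u \<longlongrightarrow> \<gamma>) (filtercomap lev at_top)"
proof -
  \<comment> \<open>The factor \<open>c\<close> comes from clearing \<open>1 / c\<close> in the
    Laplacian, \<gamma> from estimating \<open>\<gamma> - g\<close> by \<gamma>.\<close>
  have "summable (\<lambda>n. c * \<gamma> * W n)" by (rule summable_mult[OF W(3)])
  moreover have "c * \<gamma> * W n \<ge> 0" for n using W c \<gamma> by simp
  moreover have "real b > 1" using b by simp
  ultimately obtain g where g: "\<And>n. g n \<ge> 0" "\<And>n. g n \<le> g 0" "g \<longlonglongrightarrow> 0"
    "real b * (g 0 - g 1) = c * \<gamma> * W 0"
    "\<And>n. real b * (g (Suc n) - g (Suc (Suc n))) - (g n - g (Suc n)) = c * \<gamma> * W (Suc n)"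
    using radial_supersolution[of "real b" "\<lambda>n. c * \<gamma> * W n"] by blast
  define q where "q x = real (card {y. E x y}) + c * V x" for x
  have card: "real (card {y. E x y}) = real b + (if x = x0 then 0 else 1)" for x
    using model_tree_sum_radial[where x = x and g = "\<lambda>_. 1"] by simp
  have q: "q x > 0" for x
    using V[of x] c by (simp add: q_def add_nonneg_pos)
  have super: "(\<Sum>y | E x y. \<gamma>) \<le> q x * \<gamma>" for x
    using V[of x] c \<gamma> by (simp add: q_def distrib_right)
  have sub: "q x * (\<gamma> - g (lev x)) \<le> (\<Sum>y | E x y. \<gamma> - g (lev y))" for x
  proof -
    have V_le: "c * V x * (\<gamma> - g (lev x)) \<le> c * \<gamma> * W (lev x)"
    proof -
      \<comment> \<open>The difference \<open>\<gamma> - g (lev x)\<close> may be negative; the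
        estimate rests on \<open>g \<ge> 0\<close>.\<close>
      have "V x * (\<gamma> - g (lev x)) \<le> V x * \<gamma>"
        using V[of x] g(1) by (intro mult_left_mono) auto
      also have "\<dots> \<le> W (lev x) * \<gamma>"
        using W(1) \<gamma> by (intro mult_right_mono) auto
      finally show ?thesis using c by (simp add: mult.assoc mult.commute[of \<gamma>])
    qed
    show ?thesis
    \<comment> \<open>The root uses the initial equation for \<open>g\<close>, any other vertex the
      recursion at the level of its parent.\<close>
    proof (cases rule: parents[of x])
      case 1
      then show ?thesis
        using V_le g(4) unfolding model_tree_sum_radial[where x = x and g = "\<lambda>n. \<gamma> - g n"] q_def card
        by (simp add: algebra_simps)
    next
      case (2 p)
      then show ?thesis
        using V_le g(5)[of "lev p"] unfolding model_tree_sum_radial[where x = x and g = "\<lambda>n. \<gamma> - g n"] q_def card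
        by (simp add: algebra_simps)
    qed
  qed
  obtain u where u: "\<And>x. \<gamma> - g (lev x) \<le> u x" "\<And>x. u x \<le> \<gamma>"
    "\<And>x. q x * u x = sum u {y. E x y}"
    by (rule solution_between_sub_super[where q = q and N = "\<lambda>x. {y. E x y}"
          and v = "\<lambda>_. \<gamma>" and w = "\<lambda>x. \<gamma> - g (lev x)"])
      (use q super sub g(1) in auto)
  have "bounded (range u)"
  proof -
    have "range u \<subseteq> {\<gamma> - g 0..\<gamma>}"
      using u(1,2) g(2) by (fastforce intro: order_trans[OF diff_left_mono])
    then show ?thesis using bounded_closed_interval bounded_subset by blast
  qed
  moreover have "schroedinger_solution (standard_weight E) (counting_measure c) V u"
    using u(3) by (simp add: schroedinger_solution_standard_iff[OF model_tree_finite_neighbours c] q_def)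
  moreover have "(u \<longlongrightarrow> \<gamma>) (filtercomap lev at_top)"
  proof (rule tendsto_sandwich)
    have "((\<lambda>x. g (lev x)) \<longlongrightarrow> 0) (filtercomap lev at_top)"
      using g(3) filterlim_filtercomap by (rule filterlim_compose)
    from tendsto_diff[OF tendsto_const this]
    show "((\<lambda>x. \<gamma> - g (lev x)) \<longlongrightarrow> \<gamma>) (filtercomap lev at_top)" by simp
  qed (use u in auto)
  ultimately show ?thesis by blast
qed

end

theorem corollary7p4:
  fixes b :: nat
    and E :: "'v \<Rightarrow> 'v \<Rightarrow> bool"
    and x0 :: 'v
    and c \<alpha> R0 C0 :: real
    and V :: "'v \<Rightarrow> real"
  assumes "b \<ge> 2"
    and "homogeneous_model_tree b E x0"
    and "c > 0"
    and "\<And>x. V x > 0"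
    and "\<alpha> > 1" and "R0 \<ge> 2" and "C0 > 0"
    and "\<And>x. x \<notin> graph_ball E x0 R0 \<Longrightarrow> V x \<le> C0 * real (graph_dist E x x0) powr (-\<alpha>)"
  shows "infinite {u. bounded (range u) \<and>
           schroedinger_solution (standard_weight E) (counting_measure c) V u} \<and>
         (\<forall>\<gamma>>0. \<exists>u. schroedinger_solution (standard_weight E) (counting_measure c) V u \<and>
           (u \<longlongrightarrow> \<gamma>) (filtercomap (\<lambda>x. graph_dist E x x0) at_top))"
proof -
  \<comment> \<open>Inside the ball, the sum over a finite sphere dominates each value of
    \<open>V\<close> on it. This concerns finitely many \<open>n\<close>, so summability is that of
    the powers.\<close>
  define W where "W n = (if real n < R0 then \<Sum>x | graph_dist E x x0 = n. V x
                         else C0 * real n powr (-\<alpha>))" for n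
  have V_le: "V x \<le> W (graph_dist E x x0)" for x
  proof (cases "real (graph_dist E x x0) < R0")
    case True
    have "V x \<le> (\<Sum>z | graph_dist E z x0 = graph_dist E x x0. V z)"
      by (rule member_le_sum)
        (use assms(4) in \<open>auto intro: less_imp_le model_tree_finite_sphere[OF assms(2)]\<close>)
    with True show ?thesis by (simp add: W_def)
  next
    case False
    with assms(8)[of x] show ?thesis by (simp add: W_def graph_ball_def)
  qed
  have W_nonneg: "W n \<ge> 0" for n
    using assms(4,7) by (auto simp: W_def intro: sum_nonneg less_imp_le)
  have "summable W"
  proof -
    have "summable (\<lambda>n. C0 * real n powr (-\<alpha>))"
      using assms(5) by (simp add: summable_mult summable_real_powr_iff)
    moreover have "eventually (\<lambda>n. W n = C0 * real n powr (-\<alpha>)) sequentially"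
      using eventually_ge_at_top[of "nat \<lceil>R0\<rceil>"] by eventually_elim (auto simp: W_def)
    ultimately show ?thesis by (simp add: summable_cong)
  qed
  then have "\<forall>\<gamma>>0. \<exists>u. bounded (range u) \<and>
      schroedinger_solution (standard_weight E) (counting_measure c) V u \<and>
      (u \<longlongrightarrow> \<gamma>) (filtercomap (\<lambda>x. graph_dist E x x0) at_top)"
    using model_tree_solution_with_limit[where W = W, OF assms(2,1,3,4) V_le W_nonneg] by blast
  then obtain u where u: "\<And>\<gamma>. \<gamma> > 0 \<Longrightarrow> bounded (range (u \<gamma>)) \<and>
      schroedinger_solution (standard_weight E) (counting_measure c) V (u \<gamma>) \<and>
      (u \<gamma> \<longlongrightarrow> \<gamma>) (filtercomap (\<lambda>x. graph_dist E x x0) at_top)"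
    by metis
  \<comment> \<open>Distinct \<gamma> give distinct solutions, because a solution determines its
    limit at infinity.\<close>
  have "inj_on u {0<..}"
    using u tendsto_unique[OF model_tree_at_infinity_not_bot[OF assms(2)]]
    by (metis greaterThan_iff inj_onI)
  then have "infinite (u ` {0<..})"
    using infinite_Ioi finite_imageD by blast
  moreover have "u ` {0<..} \<subseteq> {u. bounded (range u) \<and>
      schroedinger_solution (standard_weight E) (counting_measure c) V u}"
    using u by auto
  ultimately show ?thesis
    using u finite_subset by blast
qed

end
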